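(* Let $n\ge1$ and let $g:\mathbb{R}_{\le 0}\times\mathbb{R}^n\to\mathbb{R}$ be in $C^{1,2}$ (once continuously differentiable in time, twice in space). Let $C$ be the continuation set of the stopping problem $V(t,\mathbf{x})=\sup_{t\le\tau\le 0}\mathbb{E}_{(t,\mathbf{x})}[g(\tau,W_\tau)]$, under the standing assumption in the context. Then $$0=\int_{-\infty}^{0}\int_{C_s}e^{\mathbf{c}\cdot\mathbf{y}+\frac{\|\mathbf{c}\|^2}{2}s}\,(-\mathcal{G}g)(s,\mathbf{y})\,d\mathbf{y}\,ds$$ for all $\mathbf{c}\in\mathbb{R}^n$ for which the integral exists (i.e. the integrand is absolutely integrable over $C$) and for which there is an $\varepsilon>0$ such that $\{(t,-t(\mathbf{c}+\mathbf{a}))\mid t\le 0,\ \mathbf{a}\in\mathbb{R}^n,\ \|\mathbf{a}\|<\varepsilon\}\cap C$ is bounded.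
   Context: $W$ is a standard $n$-dimensional Brownian motion; under $\mathbb{P}_{(t,\mathbf{x})}$ it starts at time $t\le 0$ in $\mathbf{x}\in\mathbb{R}^n$. The terminal time is $0$, and the supremum is over stopping times $\tau$ with $t\le\tau\le 0$. $\mathcal{G}:=\frac{\partial}{\partial t}+\frac12\Delta$ is the space-time generator of $(t,W_t)$. Continuation set: $C:=\{(t,\mathbf{x})\in\mathbb{R}_{\le 0}\times\mathbb{R}^n\mid V(t,\mathbf{x})>g(t,\mathbf{x})\}$. Stopping set: $S:=C^c$ (complement in $\mathbb{R}_{\le 0}\times\mathbb{R}^n$). Sections: $C_t:=\{\mathbf{x}\mid(t,\mathbf{x})\in C\}$. $p((t,\mathbf{x}),(s,\mathbf{y}))=(2\pi(s-t))^{-n/2}\exp\left(-\frac{\|\mathbf{x}-\mathbf{y}\|^2}{2(s-t)}\right)$, $t<s$, is the Brownian transition kernel. Standing assumption: the standard integral equation holds, i.e. for all $(t,\mathbf{x})\in S$, $$0=\int_t^0\int_{C_s}(-\mathcal{G}g)(s,\mathbf{y})\,p((t,\mathbf{x}),(s,\mathbf{y}))\,d\mathbf{y}\,ds.$$ *)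

theory Defs
  imports "HOL-Probability.Probability"
begin

text \<open>
  Space-time points are pairs \<open>(t, x)\<close> of type \<open>real \<times> (real ^ 'n)\<close>; only \<open>t \<le> 0\<close> is relevant.
  The dimension is \<open>CARD('n)\<close>, an arbitrary positive number.
\<close>

definition halfspace :: "(real \<times> (real ^ 'n)) set"
  where "halfspace = {..0} \<times> UNIV"


subsection \<open>Differential operators\<close>

definition time_deriv :: "(real \<times> (real ^ 'n) \<Rightarrow> real) \<Rightarrow> real \<times> (real ^ 'n) \<Rightarrow> real"
  \<comment> \<open>The derivative is taken within \<open>{..0}\<close>, so it is the left derivative at the terminal time 0.\<close>
  where "time_deriv g = (\<lambda>(t, x). vector_derivative (\<lambda>s. g (s, x)) (at t within {..0}))"

definition partial_deriv :: "'n \<Rightarrow> (real ^ 'n \<Rightarrow> real) \<Rightarrow> real ^ 'n \<Rightarrow> real"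
  where "partial_deriv i f x = deriv (\<lambda>h. f (x + h *\<^sub>R axis i 1)) 0"

definition has_partial_deriv :: "'n \<Rightarrow> (real ^ 'n \<Rightarrow> real) \<Rightarrow> real ^ 'n \<Rightarrow> bool"
  where "has_partial_deriv i f x \<longleftrightarrow> (\<lambda>h. f (x + h *\<^sub>R axis i 1)) differentiable at 0"

definition laplacian :: "(real ^ 'n \<Rightarrow> real) \<Rightarrow> real ^ 'n \<Rightarrow> real"
  where "laplacian f x = (\<Sum>i\<in>UNIV. partial_deriv i (partial_deriv i f) x)"

definition generator :: "(real \<times> (real ^ 'n) \<Rightarrow> real) \<Rightarrow> real \<times> (real ^ 'n) \<Rightarrow> real"
  where "generator g = (\<lambda>(t, x). time_deriv g (t, x) + 1 / 2 * laplacian (\<lambda>y. g (t, y)) x)"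

definition C12 :: "(real \<times> (real ^ 'n) \<Rightarrow> real) \<Rightarrow> bool"
  where "C12 g \<longleftrightarrow>
    continuous_on halfspace g \<and>
    (\<forall>(t, x)\<in>halfspace. (\<lambda>s. g (s, x)) differentiable (at t within {..0})) \<and>
    continuous_on halfspace (time_deriv g) \<and>
    (\<forall>i. (\<forall>(t, x)\<in>halfspace. has_partial_deriv i (\<lambda>y. g (t, y)) x) \<and>
         continuous_on halfspace (\<lambda>(t, x). partial_deriv i (\<lambda>y. g (t, y)) x)) \<and>
    (\<forall>i j. (\<forall>(t, x)\<in>halfspace. has_partial_deriv j (partial_deriv i (\<lambda>y. g (t, y))) x) \<and>
         continuous_on halfspace (\<lambda>(t, x). partial_deriv j (partial_deriv i (\<lambda>y. g (t, y))) x))"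


subsection \<open>Brownian motion\<close>

definition transition_kernel :: "real \<times> (real ^ 'n) \<Rightarrow> real \<times> (real ^ 'n) \<Rightarrow> real"
  \<comment> \<open>Only meaningful for \<open>t < s\<close>.\<close>
  where "transition_kernel = (\<lambda>(t, x) (s, y).
    (2 * pi * (s - t)) powr (- real CARD('n) / 2) * exp (- ((norm (x - y))\<^sup>2 / (2 * (s - t)))))"

text \<open>
  Under the measure \<open>P\<close>, the process \<open>W\<close> is a standard Brownian motion on the time interval
  \<open>[t, 0]\<close> starting at time \<open>t\<close> in \<open>x\<close>: the increment over \<open>[r, s]\<close> has law \<open>N(0, (s - r) I)\<close>,
  whose density is the transition kernel from \<open>(r, 0)\<close> to \<open>(s, \<cdot>)\<close>.
\<close>

definition brownian_motion_from ::
    "'w measure \<Rightarrow> (real \<Rightarrow> 'w \<Rightarrow> real ^ 'n) \<Rightarrow> real \<Rightarrow> real ^ 'n \<Rightarrow> bool"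
  where "brownian_motion_from P W t x \<longleftrightarrow>
    prob_space P \<and>
    (\<forall>s\<in>{t..0}. W s \<in> borel_measurable P) \<and>
    (\<forall>\<omega>\<in>space P. continuous_on {t..0} (\<lambda>s. W s \<omega>)) \<and>
    (AE \<omega> in P. W t \<omega> = x) \<and>
    (\<forall>r s. t \<le> r \<longrightarrow> r < s \<longrightarrow> s \<le> 0 \<longrightarrow>
      distributed P lborel (\<lambda>\<omega>. W s \<omega> - W r \<omega>) (\<lambda>z. ennreal (transition_kernel (r, 0) (s, z)))) \<and>
    (\<forall>(k::nat) (u::nat \<Rightarrow> real).
      (\<forall>i\<le>k. u i \<in> {t..0}) \<longrightarrow> (\<forall>i<k. u i \<le> u (Suc i)) \<longrightarrow>
      prob_space.indep_vars P (\<lambda>_. borel) (\<lambda>i \<omega>. W (u (Suc i)) \<omega> - W (u i) \<omega>) {..<k})"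

definition natural_filtration ::
    "'w measure \<Rightarrow> (real \<Rightarrow> 'w \<Rightarrow> real ^ 'n) \<Rightarrow> real \<Rightarrow> real \<Rightarrow> 'w measure"
  where "natural_filtration P W t s =
    sigma (space P) (\<Union>r\<in>{t..s}. {W r -` A \<inter> space P | A. A \<in> sets borel})"

definition stopping_times ::
    "'w measure \<Rightarrow> (real \<Rightarrow> 'w \<Rightarrow> real ^ 'n) \<Rightarrow> real \<Rightarrow> ('w \<Rightarrow> real) set"
  where "stopping_times P W t =
    {\<tau>. stopping_time (natural_filtration P W t) \<tau> \<and> (\<forall>\<omega>\<in>space P. t \<le> \<tau> \<omega> \<and> \<tau> \<omega> \<le> 0)}"


subsection \<open>The optimal stopping problem\<close>

text \<open>
  The gain function is not assumed to be bounded, so the expected gain of a stopping time is an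
  extended real, defined unless both the positive and the negative part have infinite expectation.
  (With the Bochner integral a gain that is not integrable would silently have expectation 0.)
\<close>

definition has_expectation :: "'w measure \<Rightarrow> ('w \<Rightarrow> real) \<Rightarrow> bool"
  where "has_expectation P X \<longleftrightarrow>
    (\<integral>\<^sup>+\<omega>. ennreal (X \<omega>) \<partial>P) \<noteq> \<infinity> \<or> (\<integral>\<^sup>+\<omega>. ennreal (- X \<omega>) \<partial>P) \<noteq> \<infinity>"

definition ext_expectation :: "'w measure \<Rightarrow> ('w \<Rightarrow> real) \<Rightarrow> ereal"
  \<comment> \<open>\<open>ennreal\<close> truncates at 0, so these are the expectations of the positive and negative part.\<close>
  where "ext_expectation P X =
    enn2ereal (\<integral>\<^sup>+\<omega>. ennreal (X \<omega>) \<partial>P) - enn2ereal (\<integral>\<^sup>+\<omega>. ennreal (- X \<omega>) \<partial>P)"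

text \<open>\<open>P (t, x)\<close> is the measure under which \<open>W\<close> starts at time \<open>t\<close> in \<open>x\<close>.\<close>

definition value_function ::
    "(real \<times> (real ^ 'n) \<Rightarrow> 'w measure) \<Rightarrow> (real \<Rightarrow> 'w \<Rightarrow> real ^ 'n) \<Rightarrow>
     (real \<times> (real ^ 'n) \<Rightarrow> real) \<Rightarrow> real \<times> (real ^ 'n) \<Rightarrow> ereal"
  where "value_function P W g = (\<lambda>(t, x).
    SUP \<tau> \<in> {\<tau> \<in> stopping_times (P (t, x)) W t.
               has_expectation (P (t, x)) (\<lambda>\<omega>. g (\<tau> \<omega>, W (\<tau> \<omega>) \<omega>))}.
      ext_expectation (P (t, x)) (\<lambda>\<omega>. g (\<tau> \<omega>, W (\<tau> \<omega>) \<omega>)))"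

definition continuation_set ::
    "(real \<times> (real ^ 'n) \<Rightarrow> 'w measure) \<Rightarrow> (real \<Rightarrow> 'w \<Rightarrow> real ^ 'n) \<Rightarrow>
     (real \<times> (real ^ 'n) \<Rightarrow> real) \<Rightarrow> (real \<times> (real ^ 'n)) set"
  where "continuation_set P W g = {z \<in> halfspace. value_function P W g z > ereal (g z)}"

definition stopping_set ::
    "(real \<times> (real ^ 'n) \<Rightarrow> 'w measure) \<Rightarrow> (real \<Rightarrow> 'w \<Rightarrow> real ^ 'n) \<Rightarrow>
     (real \<times> (real ^ 'n) \<Rightarrow> real) \<Rightarrow> (real \<times> (real ^ 'n)) set"
  where "stopping_set P W g = halfspace - continuation_set P W g"

definition time_section :: "(real \<times> (real ^ 'n)) set \<Rightarrow> real \<Rightarrow> (real ^ 'n) set"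
  where "time_section C t = {x. (t, x) \<in> C}"

text \<open>
  Integrability of the integrand is not part of this condition. Since a Lebesgue integral that does
  not exist has the value 0 here, the condition is implied by the integral equation under any reading
  in which the integral is also required to exist.
\<close>

definition standard_integral_equation ::
    "(real \<times> (real ^ 'n) \<Rightarrow> 'w measure) \<Rightarrow> (real \<Rightarrow> 'w \<Rightarrow> real ^ 'n) \<Rightarrow>
     (real \<times> (real ^ 'n) \<Rightarrow> real) \<Rightarrow> bool"
  where "standard_integral_equation P W g \<longleftrightarrow>
    (\<forall>(t, x) \<in> stopping_set P W g.
      0 = (LINT s:{t<..0}|lebesgue. LINT y:time_section (continuation_set P W g) s|lebesgue.
             - generator g (s, y) * transition_kernel (t, x) (s, y)))"

end

theory Submission
  imports Defs "HOL-Real_Asymp.Real_Asymp"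
begin

text \<open>
  The exponential \<open>exp (c \<bullet> y + |c|\<^sup>2 s / 2)\<close> is a Martin kernel of space-time Brownian motion: it is
  the limit of suitably normalised transition kernels whose starting point \<open>(-T, T c)\<close> runs off to
  infinity along the ray of direction \<open>c\<close>. Indeed, completing the square gives
    \<open>p((-T, T c), (s, y)) = const(T) * exp (c \<bullet> y + |c|\<^sup>2 s / 2) * D T (s, y)\<close>,
    \<open>D T (s, y) = (T / (T + s)) powr (n / 2) * exp (- |y + s c|\<^sup>2 / (2 (T + s)))\<close>
  (lemma \<open>transition_kernel_along_ray\<close>), and \<open>D T\<close>, the function \<open>kernel_ratio c T\<close>, tends to 1
  pointwise. The ray is the axis of the cone, so the boundedness assumption places \<open>(-T, T c)\<close> in the
  stopping set for all large \<open>T\<close>. The standard integral equation at this point, divided by \<open>const(T)\<close>, says that the integral over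
  \<open>C\<close> of the target integrand times \<open>D T\<close> vanishes, and the theorem follows by letting \<open>T\<close> tend to
  infinity under the integral sign.

  The one thing to check is that \<open>D T\<close> is bounded on \<open>C\<close> uniformly in all large \<open>T\<close>
  (lemma \<open>kernel_ratio_bounded_off_cone\<close>), so that a multiple of the target integrand dominates. Only
  the singularity of \<open>D T\<close> at \<open>(-T, T c)\<close> matters. For \<open>s \<ge> -T / 2\<close> the power is at most
  \<open>2 powr (n / 2)\<close>. For \<open>s < -T / 2\<close>, points of \<open>C\<close> lie outside the cone once \<open>T\<close> is large, that is
  \<open>|y + s c| \<ge> \<epsilon> |s| > \<epsilon> T / 2\<close>, and then the Gaussian factor beats the power.
\<close>

section \<open>Fubini's theorem for the completed Lebesgue measure\<close>

text \<open>
  Lebesgue measure on a product is the completion of the product measure, not the product measure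
  itself. A Lebesgue measurable function agrees almost everywhere with a Borel function, and by
  Fubini's theorem the exceptional null set has null sections almost everywhere, so that the inner
  and the outer integral are those of the Borel function.
\<close>
lemma integral_lebesgue_fst:
  fixes f :: "'a::euclidean_space \<times> 'b::euclidean_space \<Rightarrow> real"
  assumes f: "integrable lebesgue f"
  shows "(LINT x|lebesgue. LINT y|lebesgue. f (x, y)) = integral\<^sup>L lebesgue f"
proof -
  obtain h where h [measurable]: "h \<in> borel_measurable lborel" and fh: "AE z in lborel. f z = h z"
    using completion_ex_borel_measurable_real borel_measurable_integrable[OF f] by blast
  have "AE z in lebesgue. f z = h z"
    using fh by (rule AE_completion)
  then have int: "integrable lebesgue h" "integral\<^sup>L lebesgue f = integral\<^sup>L lebesgue h"
    using f borel_measurable_integrable[OF f] measurable_completion[OF h]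
    by (auto intro: integrable_cong_AE_imp integral_cong_AE simp: eq_commute)
  have h_prod: "integrable (lborel \<Otimes>\<^sub>M lborel) h"
    using int(1) by (simp add: lborel_prod integrable_completion)
  have section_measurable: "(\<lambda>y. h (x, y)) \<in> borel_measurable lborel" for x
    by measurable
  have "AE x in lborel. AE y in lborel. f (x, y) = h (x, y)"
    using fh unfolding lborel_prod[symmetric] by (rule lborel_pair.AE_pair)
  then have sections: "AE x in lborel. (LINT y|lborel. h (x, y)) = (LINT y|lebesgue. f (x, y))"
  proof eventually_elim
    case (elim x)
    then have ae: "AE y in lebesgue. h (x, y) = f (x, y)"
      by (auto intro: AE_completion simp: eq_commute)
    moreover have "(\<lambda>y. h (x, y)) \<in> borel_measurable lebesgue"
      by (intro measurable_completion section_measurable)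
    ultimately have "(LINT y|lebesgue. h (x, y)) = (LINT y|lebesgue. f (x, y))"
      by (intro integral_cong_AE) (auto intro: borel_measurable_AE)
    then show ?case
      by (simp add: integral_completion section_measurable)
  qed
  have inner: "(\<lambda>x. LINT y|lborel. h (x, y)) \<in> borel_measurable lborel"
    using lborel_pair.integrable_fst'[OF h_prod] by (rule borel_measurable_integrable)
  then have inner_lebesgue: "(\<lambda>x. LINT y|lborel. h (x, y)) \<in> borel_measurable lebesgue"
    by (rule measurable_completion)
  have "(LINT x|lebesgue. LINT y|lebesgue. f (x, y)) = (LINT x|lebesgue. LINT y|lborel. h (x, y))"
    using AE_completion[OF sections]
    by (intro integral_cong_AE[symmetric] inner_lebesgue borel_measurable_AE[OF inner_lebesgue])
  also have "\<dots> = (LINT x|lborel. LINT y|lborel. h (x, y))"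
    using inner by (rule integral_completion)
  also have "\<dots> = integral\<^sup>L lebesgue h"
    using lborel_pair.integral_fst'[OF h_prod] by (simp add: lborel_prod integral_completion)
  finally show ?thesis
    using int(2) by simp
qed

text \<open>
  The iterated integrals of the optimal stopping problem run over a time interval \<open>A\<close> and the sections
  of a space-time set \<open>C\<close>; \<open>F\<close> carries the indicator functions of both.
\<close>
lemma iterated_integral_time_section:
  fixes C :: "(real \<times> (real ^ 'n)) set" and F :: "real \<times> (real ^ 'n) \<Rightarrow> real"
  assumes F: "integrable lebesgue F"
    and F_eq: "\<And>s y. F (s, y) = indicator A s * (indicator C (s, y) * f s y)"
  shows "(LINT s:A|lebesgue. LINT y:time_section C s|lebesgue. f s y) = integral\<^sup>L lebesgue F"
proof -
  have "indicator (time_section C s) y = (indicator C (s, y) :: real)" for s y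
    by (simp add: time_section_def indicator_def)
  then have "(LINT s:A|lebesgue. LINT y:time_section C s|lebesgue. f s y)
      = (LINT s|lebesgue. LINT y|lebesgue. F (s, y))"
    by (simp add: set_lebesgue_integral_def F_eq)
  then show ?thesis
    using integral_lebesgue_fst[OF F] by simp
qed

section \<open>Transition kernels started far away along a ray\<close>

text \<open>
  The transition kernel started in \<open>(-T, T c)\<close>, relative to its limit
  \<open>exp (c \<bullet> y + |c|\<^sup>2 s / 2)\<close> and to a normalising constant. The value 0 before the starting
  time \<open>-T\<close> turns integrals over \<open>{-T<..0}\<close> into integrals over \<open>{..0}\<close>.
\<close>
definition kernel_ratio :: "real ^ 'n \<Rightarrow> real \<Rightarrow> real \<times> (real ^ 'n) \<Rightarrow> real"
  where "kernel_ratio c T = (\<lambda>(s, y). if - T < s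
    then (T / (T + s)) powr (real CARD('n) / 2) * exp (- ((norm (y + s *\<^sub>R c))\<^sup>2 / (2 * (T + s))))
    else 0)"

lemma kernel_ratio_nonneg: "0 \<le> kernel_ratio c T z"
  by (simp add: kernel_ratio_def split: prod.split)

lemma kernel_ratio_measurable [measurable]: "kernel_ratio c T \<in> borel_measurable borel"
  unfolding kernel_ratio_def borel_prod[symmetric] by measurable

lemma kernel_ratio_tendsto:
  fixes c :: "real ^ 'n"
  shows "((\<lambda>T. kernel_ratio c T (s, y)) \<longlongrightarrow> 1) at_top"
proof -
  let ?f = "\<lambda>T. (T / (T + s)) powr (real CARD('n) / 2)
      * exp (- ((norm (y + s *\<^sub>R c))\<^sup>2 / (2 * (T + s))))"
  have "(?f \<longlongrightarrow> 1) at_top"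
    by real_asymp
  moreover have "\<forall>\<^sub>F T in at_top. ?f T = kernel_ratio c T (s, y)"
    using eventually_gt_at_top[of "- s"] by eventually_elim (simp add: kernel_ratio_def)
  ultimately show ?thesis
    by (rule Lim_transform_eventually)
qed

lemma transition_kernel_along_ray:
  fixes c :: "real ^ 'n"
  assumes "0 < T" "- T < s"
  shows "transition_kernel (- T, T *\<^sub>R c) (s, y)
    = (2 * pi * T) powr (- real CARD('n) / 2) * exp (- ((norm c)\<^sup>2 / 2 * T))
      * (exp (c \<bullet> y + (norm c)\<^sup>2 / 2 * s) * kernel_ratio c T (s, y))"
proof -
  define u where "u = T + s"
  have u: "u > 0" and s: "s = u - T"
    using assms by (auto simp: u_def)
  (* Completing the square in the exponent: T^2 / u = T - s + s^2 / u and T / u = 1 - s / u. *)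
  have "- ((norm (T *\<^sub>R c - y))\<^sup>2 / (2 * u))
      = - ((norm c)\<^sup>2 / 2 * T) + (c \<bullet> y + (norm c)\<^sup>2 / 2 * s) - (norm (y + s *\<^sub>R c))\<^sup>2 / (2 * u)"
    using u unfolding power2_norm_eq_inner
    by (simp add: s inner_commute field_simps inner_add_left inner_add_right
        inner_diff_left inner_diff_right power2_eq_square)
  then have "exp (- ((norm (T *\<^sub>R c - y))\<^sup>2 / (2 * u)))
      = exp (- ((norm c)\<^sup>2 / 2 * T)) * exp (c \<bullet> y + (norm c)\<^sup>2 / 2 * s)
        * exp (- ((norm (y + s *\<^sub>R c))\<^sup>2 / (2 * u)))"
    by (simp flip: exp_add)
  moreover have "(2 * pi * u) powr (- real CARD('n) / 2)
      = (2 * pi * T) powr (- real CARD('n) / 2) * (T / u) powr (real CARD('n) / 2)"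
    using u assms by (simp add: powr_mult powr_divide powr_minus field_simps)
  ultimately show ?thesis
    using assms by (simp add: transition_kernel_def kernel_ratio_def u_def add.commute)
qed

section \<open>A uniform bound off the cone\<close>

lemma powr_le_exp:
  fixes u r k :: real
  assumes "u > 0" "r > 0" "k > 0"
  shows "u powr r \<le> (r / k) powr r * exp (k * u)"
proof -
  have "k * u / r \<le> exp (k * u / r)"
    using exp_ge_add_one_self[of "k * u / r"] by linarith
  then have "(k * u / r) powr r \<le> exp (k * u / r) powr r"
    using assms by (intro powr_mono2) auto
  also have "\<dots> = exp (k * u)"
    using assms by (simp add: powr_def)
  finally have "(r / k) powr r * (k * u / r) powr r \<le> (r / k) powr r * exp (k * u)"
    by (intro mult_left_mono) auto
  moreover have "(r / k) powr r * (k * u / r) powr r = u powr r"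
    using assms by (subst powr_mult[symmetric]) auto
  ultimately show ?thesis
    by simp
qed

text \<open>
  Off the cone, close to the starting time, \<open>u = T / (T + s)\<close> is large but the Gaussian factor is at
  most \<open>exp (- \<epsilon>\<^sup>2 T u / 8)\<close>; with \<open>T \<ge> 1\<close> this compensates the power \<open>u powr (n / 2)\<close>.
\<close>
lemma kernel_ratio_bounded_off_cone:
  fixes c :: "real ^ 'n"
  assumes "\<epsilon> > 0" "T \<ge> 1" "s \<le> 0"
    and off_cone: "s < - T / 2 \<Longrightarrow> \<epsilon> * (- s) \<le> norm (y + s *\<^sub>R c)"
  shows "kernel_ratio c T (s, y)
    \<le> 2 powr (real CARD('n) / 2) + (real CARD('n) / 2 / (\<epsilon>\<^sup>2 / 8)) powr (real CARD('n) / 2)"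
proof -
  define r where "r = real CARD('n) / 2"
  define k where "k = \<epsilon>\<^sup>2 / 8"
  define u where "u = T / (T + s)"
  have r: "r > 0" and k: "k > 0"
    using assms by (auto simp: r_def k_def)
  have "kernel_ratio c T (s, y) \<le> 2 powr r + (r / k) powr r"
  proof (cases "- T < s")
    case False
    then show ?thesis
      by (simp add: kernel_ratio_def)
  next
    case True
    then have u: "u > 0"
      using assms by (simp add: u_def)
    have K: "kernel_ratio c T (s, y) = u powr r * exp (- ((norm (y + s *\<^sub>R c))\<^sup>2 / (2 * (T + s))))"
      using True by (simp add: kernel_ratio_def u_def r_def)
    show ?thesis
    proof (cases "s < - T / 2")
      case False
      then have "u \<le> 2"
        using True assms by (simp add: u_def field_simps)
      then have "u powr r \<le> 2 powr r"
        using u r by (intro powr_mono2) auto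
      moreover have "exp (- ((norm (y + s *\<^sub>R c))\<^sup>2 / (2 * (T + s)))) \<le> 1"
        using True by simp
      ultimately have "kernel_ratio c T (s, y) \<le> 2 powr r * 1"
        unfolding K by (intro mult_mono) auto
      then show ?thesis
        by (simp add: add_increasing2)
    next
      case near: True
      have "\<epsilon> * (T / 2) \<le> \<epsilon> * (- s)"
        using near assms by (intro mult_left_mono) auto
      then have "\<epsilon> * T / 2 \<le> norm (y + s *\<^sub>R c)"
        using off_cone[OF near] by simp
      then have "(\<epsilon> * T / 2)\<^sup>2 \<le> (norm (y + s *\<^sub>R c))\<^sup>2"
        using assms by (intro power_mono) auto
      then have "(\<epsilon> * T / 2)\<^sup>2 / (2 * (T + s)) \<le> (norm (y + s *\<^sub>R c))\<^sup>2 / (2 * (T + s))"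
        using True by (intro divide_right_mono) auto
      moreover have "(\<epsilon> * T / 2)\<^sup>2 / (2 * (T + s)) = T * (k * u)"
        using True by (simp add: k_def u_def field_simps power2_eq_square)
      moreover have "k * u \<le> T * (k * u)"
        using assms k u by simp
      ultimately have "kernel_ratio c T (s, y) \<le> u powr r * exp (- (k * u))"
        unfolding K by (intro mult_left_mono) auto
      also have "\<dots> \<le> ((r / k) powr r * exp (k * u)) * exp (- (k * u))"
        using powr_le_exp[OF u r k] by (intro mult_right_mono) auto
      also have "\<dots> = (r / k) powr r"
        by (simp add: exp_minus)
      finally show ?thesis
        by (simp add: add_increasing)
    qed
  qed
  then show ?thesis
    by (simp add: r_def k_def)
qed

section \<open>The integral equation with exponential weight\<close>

theorem theorem2p4:
  fixes P :: "real \<times> (real ^ 'n) \<Rightarrow> 'w measure"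
    and W :: "real \<Rightarrow> 'w \<Rightarrow> real ^ 'n"
    and g :: "real \<times> (real ^ 'n) \<Rightarrow> real"
    and C :: "(real \<times> (real ^ 'n)) set"
    and c :: "real ^ 'n"
  assumes brownian: "\<And>t x. t \<le> 0 \<Longrightarrow> brownian_motion_from (P (t, x)) W t x"
    and g: "C12 g"
    and C: "C = continuation_set P W g"
    and integral_equation: "standard_integral_equation P W g"
    and integrable: "(\<lambda>(s, y). exp (c \<bullet> y + (norm c)\<^sup>2 / 2 * s) * (- generator g (s, y)))
                       absolutely_integrable_on C"
    and cone: "\<exists>\<epsilon>>0. bounded ({(t, (- t) *\<^sub>R (c + a)) | t a. t \<le> 0 \<and> norm a < \<epsilon>} \<inter> C)"
  shows "0 = (LINT s:{..0}|lebesgue. LINT y:time_section C s|lebesgue.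
                exp (c \<bullet> y + (norm c)\<^sup>2 / 2 * s) * (- generator g (s, y)))"
proof -
  have C_time: "s \<le> 0" if "(s, y) \<in> C" for s y
    using that by (simp add: C continuation_set_def halfspace_def)
  obtain \<epsilon> where \<epsilon>: "\<epsilon> > 0"
    and bdd: "bounded ({(t, (- t) *\<^sub>R (c + a)) | t a. t \<le> 0 \<and> norm a < \<epsilon>} \<inter> C)" (is "bounded (?K \<inter> C)")
    using cone by blast
  obtain M where M: "\<And>z. z \<in> ?K \<inter> C \<Longrightarrow> norm z \<le> M"
    using bdd by (auto simp: bounded_iff)
  have no_cone: "(s, y) \<notin> ?K" if "(s, y) \<in> C" "\<bar>s\<bar> > M" for s y
    using M[of "(s, y)"] norm_fst_le[of s y] that by auto

  define weight where "weight = (\<lambda>(s, y). exp (c \<bullet> y + (norm c)\<^sup>2 / 2 * s) * (- generator g (s, y)))"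
  define \<Phi> where "\<Phi> = (\<lambda>z. indicator C z * weight z)"
  define B where "B = 2 powr (real CARD('n) / 2)
    + (real CARD('n) / 2 / (\<epsilon>\<^sup>2 / 8)) powr (real CARD('n) / 2)"
  define R where "R T = (\<lambda>z. \<Phi> z * kernel_ratio c T z)" for T
  have \<Phi>_int: "integrable lebesgue \<Phi>"
    using integrable by (simp add: set_integrable_def \<Phi>_def weight_def)
  have \<Phi>_meas: "\<Phi> \<in> borel_measurable lebesgue"
    using \<Phi>_int by (rule borel_measurable_integrable)
  have "kernel_ratio c T \<in> borel_measurable lebesgue" for T
    by (intro measurable_completion) measurable
  then have R_meas: "R T \<in> borel_measurable lebesgue" for T
    unfolding R_def by (intro borel_measurable_times \<Phi>_meas)
  have dominating: "integrable lebesgue (\<lambda>z. B * norm (\<Phi> z))"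
    using \<Phi>_int by simp

  have R_bound: "norm (R T z) \<le> B * norm (\<Phi> z)" if T: "T \<ge> 1" "T > 2 * M" for T z
  proof (cases "z \<in> C")
    case True
    obtain s y where z: "z = (s, y)"
      by force
    have s: "s \<le> 0"
      using C_time True by (simp add: z)
    have "\<epsilon> * (- s) \<le> norm (y + s *\<^sub>R c)" if "s < - T / 2"
    proof (rule ccontr)
      assume small: "\<not> \<epsilon> * (- s) \<le> norm (y + s *\<^sub>R c)"
      (* In the coordinates of the cone, y = - s (c + a) for the following a. *)
      define a where "a = (1 / - s) *\<^sub>R (y + s *\<^sub>R c)"
      have "s < 0"
        using that T by simp
      then have y: "y = (- s) *\<^sub>R (c + a)"
        by (simp add: a_def scaleR_add_right)
      have "norm a = norm (y + s *\<^sub>R c) / - s"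
        unfolding a_def norm_scaleR using \<open>s < 0\<close> by simp
      also have "\<dots> < \<epsilon>"
        using small \<open>s < 0\<close> by (subst pos_divide_less_eq) auto
      finally have "(s, y) \<in> ?K"
        using s y by blast
      moreover have "\<bar>s\<bar> > M"
        using that T by simp
      ultimately show False
        using no_cone[of s y] True unfolding z by blast
    qed
    then have "kernel_ratio c T z \<le> B"
      unfolding z B_def using \<epsilon> T s by (intro kernel_ratio_bounded_off_cone) auto
    then have "kernel_ratio c T z * norm (\<Phi> z) \<le> B * norm (\<Phi> z)"
      by (intro mult_right_mono) auto
    then show ?thesis
      using kernel_ratio_nonneg[of c T z] by (simp add: R_def abs_mult mult.commute)
  next
    case False
    then show ?thesis
      by (simp add: R_def \<Phi>_def)
  qed

  have R_zero: "integral\<^sup>L lebesgue (R T) = 0" if T: "T \<ge> 1" "T > 2 * M" for T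
  proof -
    define \<kappa> where "\<kappa> = (2 * pi * T) powr (- real CARD('n) / 2) * exp (- ((norm c)\<^sup>2 / 2 * T))"
    have "\<kappa> \<noteq> 0"
      using T by (simp add: \<kappa>_def)
    have "integrable lebesgue (R T)"
      using dominating R_meas
      by (rule Bochner_Integration.integrable_bound)
         (use order_trans[OF R_bound[OF T] abs_ge_self] in \<open>simp only: real_norm_def AE_I2\<close>)
    then have int: "integrable lebesgue (\<lambda>z. \<kappa> * R T z)"
      by simp
    (* The axis of the cone, a = 0, leaves C for good because its intersection with C is bounded. *)
    have "(- T, T *\<^sub>R c) \<in> ?K"
      using T \<epsilon> by (auto intro!: exI[of _ "- T"] exI[of _ 0])
    then have "(- T, T *\<^sub>R c) \<notin> C"
      using no_cone[of "- T" "T *\<^sub>R c"] T by auto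
    then have "(- T, T *\<^sub>R c) \<in> stopping_set P W g"
      using T by (simp add: stopping_set_def C halfspace_def)
    then have "0 = (LINT s:{-T<..0}|lebesgue. LINT y:time_section C s|lebesgue.
        - generator g (s, y) * transition_kernel (- T, T *\<^sub>R c) (s, y))"
      using integral_equation by (auto simp: standard_integral_equation_def C)
    also have "\<dots> = integral\<^sup>L lebesgue (\<lambda>z. \<kappa> * R T z)"
    proof (rule iterated_integral_time_section[OF int])
      fix s y
      consider "(s, y) \<notin> C" | "(s, y) \<in> C" "s \<le> - T" | "(s, y) \<in> C" "- T < s" "s \<le> 0"
        using C_time[of s y] by linarith
      then show "\<kappa> * R T (s, y) = indicator {-T<..0} s *
          (indicator C (s, y) * (- generator g (s, y) * transition_kernel (- T, T *\<^sub>R c) (s, y)))"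
      proof cases
        case 3
        then show ?thesis
          using T transition_kernel_along_ray[of T s c y]
          by (simp add: R_def \<Phi>_def weight_def \<kappa>_def)
      qed (auto simp: R_def \<Phi>_def kernel_ratio_def)
    qed
    also have "\<dots> = \<kappa> * integral\<^sup>L lebesgue (R T)"
      by simp
    finally show ?thesis
      using \<open>\<kappa> \<noteq> 0\<close> by simp
  qed

  have large: "\<forall>\<^sub>F T in at_top. T \<ge> 1 \<and> T > 2 * M"
    using eventually_ge_at_top eventually_gt_at_top by (rule eventually_conj)
  have "((\<lambda>T. R T z) \<longlongrightarrow> \<Phi> z) at_top" for z
    using tendsto_mult_left[OF kernel_ratio_tendsto, of "\<Phi> z" c "fst z" "snd z"] by (simp add: R_def)
  moreover have "\<forall>\<^sub>F T in at_top. AE z in lebesgue. norm (R T z) \<le> B * norm (\<Phi> z)"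
    using large by eventually_elim (use R_bound in auto)
  ultimately have "((\<lambda>T. integral\<^sup>L lebesgue (R T)) \<longlongrightarrow> integral\<^sup>L lebesgue \<Phi>) at_top"
    by (intro integral_dominated_convergence_at_top[OF \<Phi>_meas R_meas dominating]) auto
  moreover have "((\<lambda>T. integral\<^sup>L lebesgue (R T)) \<longlongrightarrow> 0) at_top"
    using R_zero by (intro tendsto_eventually eventually_mono[OF large]) auto
  ultimately have "integral\<^sup>L lebesgue \<Phi> = 0"
    using tendsto_unique trivial_limit_at_top_linorder by blast
  moreover have "(LINT s:{..0}|lebesgue. LINT y:time_section C s|lebesgue.
      exp (c \<bullet> y + (norm c)\<^sup>2 / 2 * s) * (- generator g (s, y))) = integral\<^sup>L lebesgue \<Phi>"
    by (rule iterated_integral_time_section[OF \<Phi>_int])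
       (use C_time in \<open>auto simp: \<Phi>_def weight_def indicator_def\<close>)
  ultimately show ?thesis
    by simp
qed

end
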